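(* Work in ZFC. The hypotheses $\mathbf{Sy}_{\mathbb{R}}$, $\mathbf{Un}$ and $\mathbf{Po}$, or the stronger hypotheses $\mathbf{Sy}_{\mathbb{R}}$, $\mathbf{Un}$ and $\mathbf{Tot}$, are insufficient to determine uniquely a (real-valued) notion of chance for the spinner. That is: (1) there exist two distinct real-valued models of chance on $[0,1)$ each satisfying $\mathbf{Sy}_{\mathbb{R}}$, $\mathbf{Un}$ and $\mathbf{Po}$; (2) there exist two distinct real-valued models of chance on $[0,1)$ each satisfying $\mathbf{Sy}_{\mathbb{R}}$, $\mathbf{Un}$ and $\mathbf{Tot}$.
   Context: The "spinner" is a uniform process whose outcome is a point of the sample space $[0,1)\subseteq\mathbb{R}$. A real-valued (Archimedean) model of chance for it is a finitely additive (possibly $\sigma$-additive) probability measure $\mu:\mathcal{A}\to[0,1]$, $\mu([0,1))=1$, defined on an algebra $\mathcal{A}$ of subsets of $[0,1)$. Two models are distinct if they differ as functions (i.e. have different domains, or the same domain and different values). The hypotheses are: - $\mathbf{Sy}_{\mathbb{R}}$: the chance is invariant with respect to rotations by an arbitrary real angle, equivalently with respect to translations modulo $1$ by any real number: for every $A\in\mathcal{A}$ and $r\in\mathbb{R}$, the set $A+r \bmod 1=\{(a+r)\bmod 1 : a\in A\}$ belongs to $\mathcal{A}$ and $\mu(A+r\bmod 1)=\mu(A)$. - $\mathbf{Un}$ (uniformity, for real-valued models): intervals contained in $[0,1)$ belong to $\mathcal{A}$, and two intervals of the same length have the same chance. - $\mathbf{Po}$: every point outcome is possible and is assigned a probability,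 i.e. $\{x\}\in\mathcal{A}$ for every $x\in[0,1)$ (this probability may be $0$). - $\mathbf{Tot}$: every set outcome is assigned a probability, i.e. $\mathcal{A}=\mathcal{P}([0,1))$. *)

theory Defs
  imports "HOL-Analysis.Analysis"
begin

text \<open>
  A model of chance is given by its domain \<open>\<A>\<close> and a function \<open>\<mu>\<close> on all sets of reals;
  only the values of \<open>\<mu>\<close> on \<open>\<A>\<close> are meaningful.
\<close>

definition spinner_space :: "real set" where
  "spinner_space = {0..<1}"

definition chance_model :: "real set set \<Rightarrow> (real set \<Rightarrow> real) \<Rightarrow> bool" where
  "chance_model \<A> \<mu> \<longleftrightarrow>
     algebra spinner_space \<A> \<and> \<mu> \<in> \<A> \<rightarrow> {0..1} \<and> \<mu> spinner_space = 1 \<and> additive \<A> \<mu>"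

text \<open>Inequality as partial functions: values outside the domains are irrelevant.\<close>

definition distinct_models ::
  "real set set \<Rightarrow> (real set \<Rightarrow> real) \<Rightarrow> real set set \<Rightarrow> (real set \<Rightarrow> real) \<Rightarrow> bool" where
  "distinct_models \<A> \<mu> \<B> \<nu> \<longleftrightarrow> \<A> \<noteq> \<B> \<or> (\<exists>A\<in>\<A>. \<mu> A \<noteq> \<nu> A)"

definition translate_mod1 :: "real \<Rightarrow> real set \<Rightarrow> real set" where
  "translate_mod1 r A = (\<lambda>a. frac (a + r)) ` A"

definition Sy_R :: "real set set \<Rightarrow> (real set \<Rightarrow> real) \<Rightarrow> bool" where
  "Sy_R \<A> \<mu> \<longleftrightarrow>
     (\<forall>A\<in>\<A>. \<forall>r. translate_mod1 r A \<in> \<A> \<and> \<mu> (translate_mod1 r A) = \<mu> A)"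

text \<open>
  Intervals are nonempty and may be open, closed or half-open; a one-point set is an interval of
  length \<open>0\<close>. As \<open>I\<close> is nonempty and bounded, \<open>Sup I - Inf I\<close> is the distance of its endpoints.
\<close>

definition spinner_intervals :: "real set set" where
  "spinner_intervals = {I. is_interval I \<and> I \<noteq> {} \<and> I \<subseteq> spinner_space}"

definition interval_length :: "real set \<Rightarrow> real" where
  "interval_length I = Sup I - Inf I"

definition Un_R :: "real set set \<Rightarrow> (real set \<Rightarrow> real) \<Rightarrow> bool" where
  "Un_R \<A> \<mu> \<longleftrightarrow>
     spinner_intervals \<subseteq> \<A> \<and>
     (\<forall>I\<in>spinner_intervals. \<forall>J\<in>spinner_intervals.
        interval_length I = interval_length J \<longrightarrow> \<mu> I = \<mu> J)"

definition Po :: "real set set \<Rightarrow> bool" where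
  "Po \<A> \<longleftrightarrow> (\<forall>x\<in>spinner_space. {x} \<in> \<A>)"

definition Tot :: "real set set \<Rightarrow> bool" where
  "Tot \<A> \<longleftrightarrow> \<A> = Pow spinner_space"

end

theory Submission
  imports Defs
begin

text \<open>
  There is an additive \<open>f : \<real> \<rightarrow> \<real>\<close> that vanishes at \<open>1\<close> without vanishing identically, so \<open>f\<close> is
  constant on classes modulo \<open>1\<close> and unbounded in both directions. The sets \<open>{f \<ge> c}\<close> are permuted
  by translations and have the finite intersection property, so some finitely additive probability
  gives all of them the value \<open>1\<close>, and averaging along commuting translations (the Markov--Kakutani
  argument) makes it invariant. The same construction for \<open>-f\<close> gives the sets \<open>{f \<ge> c}\<close> the
  value \<open>0\<close>. Uniformity of a total model is a consequence of invariance, since points are null.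
\<close>

section \<open>Invariant finitely additive probabilities\<close>

text \<open>Set functions defined on every subset, so that this is a subset of the product space
  \<open>'a set \<Rightarrow> real\<close>, where Tychonoff's theorem applies.\<close>

definition fin_add_probs :: "('a set \<Rightarrow> real) set" where
  "fin_add_probs = {m. (\<forall>A. 0 \<le> m A \<and> m A \<le> 1) \<and> m UNIV = 1 \<and>
     (\<forall>A B. A \<inter> B = {} \<longrightarrow> m (A \<union> B) = m A + m B)}"

lemma fin_add_probs_bounds:
  assumes "m \<in> fin_add_probs"
  shows "0 \<le> m A" "m A \<le> 1"
  using assms by (auto simp: fin_add_probs_def)

text \<open>Each condition is an equation or a weak inequality between finitely many coordinates,
  and coordinates are continuous.\<close>

lemma closed_fin_add_probs: "closed (fin_add_probs :: ('a set \<Rightarrow> real) set)"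
  unfolding fin_add_probs_def
  by (intro closed_Collect_conj closed_Collect_all closed_Collect_imp closed_Collect_le
        closed_Collect_eq continuous_intros continuous_on_product_coordinates) simp

lemma compact_fin_add_probs: "compact (fin_add_probs :: ('a set \<Rightarrow> real) set)"
proof -
  have "compactin (product_topology (\<lambda>_. euclidean) UNIV)
          (PiE UNIV (\<lambda>_. {0..1}) :: ('a set \<Rightarrow> real) set)"
    by (simp add: compactin_PiE)
  then have "compact (PiE UNIV (\<lambda>_. {0..1}) :: ('a set \<Rightarrow> real) set)"
    by (simp add: euclidean_product_topology)
  then have "compact (PiE UNIV (\<lambda>_. {0..1}) \<inter> (fin_add_probs :: ('a set \<Rightarrow> real) set))"
    using closed_fin_add_probs by (rule compact_Int_closed)
  moreover have "PiE UNIV (\<lambda>_. {0..1}) \<inter> fin_add_probs = (fin_add_probs :: ('a set \<Rightarrow> real) set)"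
    by (auto simp: fin_add_probs_def PiE_def Pi_def)
  ultimately show ?thesis by simp
qed

lemma point_mass_fin_add_probs: "(\<lambda>A. of_bool (x \<in> A)) \<in> fin_add_probs"
  by (auto simp: fin_add_probs_def)

text \<open>Finitely many members of \<open>F\<close> share a point, and the point mass there gives
  each of them the value 1. Compactness then meets all these closed conditions at once.\<close>

lemma fip_imp_fin_add_prob:
  assumes fip: "\<And>G. finite G \<Longrightarrow> G \<subseteq> F \<Longrightarrow> \<Inter>G \<noteq> {}"
  shows "\<exists>m\<in>fin_add_probs. \<forall>A\<in>F. m A = 1"
proof -
  have "fin_add_probs \<inter> (\<Inter>A\<in>F. {m. m A = 1}) \<noteq> {}"
  proof (rule compact_imp_fip_image[OF compact_fin_add_probs])
    show "closed {m :: 'a set \<Rightarrow> real. m A = 1}" for A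
      by (intro closed_Collect_eq continuous_intros continuous_on_product_coordinates)
    fix G assume "finite G" "G \<subseteq> F"
    then obtain x where "x \<in> \<Inter>G" using fip by blast
    then have "(\<lambda>A. of_bool (x \<in> A)) \<in> fin_add_probs \<inter> (\<Inter>A\<in>G. {m. m A = 1})"
      by (auto simp: point_mass_fin_add_probs)
    then show "fin_add_probs \<inter> (\<Inter>A\<in>G. {m. m A = (1::real)}) \<noteq> {}" by blast
  qed
  then show ?thesis by blast
qed

text \<open>The mean of the push-forwards of \<open>m\<close> under the first \<open>n\<close>
  powers of \<open>h\<close>, starting at the identity.\<close>

definition orbit_average :: "('a \<Rightarrow> 'a) \<Rightarrow> nat \<Rightarrow> ('a set \<Rightarrow> real) \<Rightarrow> 'a set \<Rightarrow> real" where
  "orbit_average h n m A = (\<Sum>i<n. m ((h ^^ i) -` A)) / real n"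

lemma orbit_average_fin_add_probs:
  assumes m: "m \<in> fin_add_probs" and n: "n > 0"
  shows "orbit_average h n m \<in> fin_add_probs"
proof -
  have "(\<Sum>i<n. m ((h ^^ i) -` A)) \<le> real n" for A
    using sum_bounded_above[of "{..<n}" "\<lambda>i. m ((h ^^ i) -` A)" 1] fin_add_probs_bounds[OF m]
    by simp
  moreover have "(\<Sum>i<n. m ((h ^^ i) -` A)) \<ge> 0" for A
    using fin_add_probs_bounds[OF m] by (simp add: sum_nonneg)
  moreover have "m ((h ^^ i) -` (A \<union> B)) = m ((h ^^ i) -` A) + m ((h ^^ i) -` B)"
    if "A \<inter> B = {}" for A B i
  proof -
    have "(h ^^ i) -` A \<inter> (h ^^ i) -` B = {}" using that by blast
    then show ?thesis using m by (simp add: fin_add_probs_def vimage_Un)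
  qed
  moreover have "m UNIV = 1" using m by (simp add: fin_add_probs_def)
  ultimately show ?thesis
    using n by (simp add: fin_add_probs_def orbit_average_def sum.distrib add_divide_distrib)
qed

text \<open>A preimage under \<open>h\<close> shifts the index by one, so the difference of the sums
  telescopes to a difference of two values in [0,1].\<close>

lemma orbit_average_almost_invariant:
  assumes m: "m \<in> fin_add_probs" and n: "n > 0"
  shows "\<bar>orbit_average h n m (h -` A) - orbit_average h n m A\<bar> \<le> 1 / real n"
proof -
  have "(h ^^ i) -` (h -` A) = (h ^^ Suc i) -` A" for i
    by auto
  then have "(\<Sum>i<n. m ((h ^^ i) -` (h -` A))) - (\<Sum>i<n. m ((h ^^ i) -` A))
      = (\<Sum>i<n. m ((h ^^ Suc i) -` A) - m ((h ^^ i) -` A))"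
    by (simp add: sum_subtractf)
  also have "\<dots> = m ((h ^^ n) -` A) - m A"
    by (subst sum_lessThan_telescope) simp
  finally have "orbit_average h n m (h -` A) - orbit_average h n m A
      = (m ((h ^^ n) -` A) - m A) / real n"
    by (simp add: orbit_average_def flip: diff_divide_distrib)
  moreover have "\<bar>m ((h ^^ n) -` A) - m A\<bar> \<le> 1"
    using fin_add_probs_bounds[OF m, of A] fin_add_probs_bounds[OF m, of "(h ^^ n) -` A"]
    by linarith
  ultimately show ?thesis using n by (simp add: divide_right_mono)
qed

lemma funpow_comp_commute:
  assumes "g \<circ> h = h \<circ> g"
  shows "g \<circ> (h ^^ i) = (h ^^ i) \<circ> g"
proof (induction i)
  case (Suc i)
  then show ?case
    using assms by (simp add: fun_eq_iff)
qed simp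

text \<open>Preimages under \<open>g\<close> pass through the powers of \<open>h\<close>, so every
  summand has defect at most \<open>e\<close>. Averaging over \<open>h\<close> thus keeps what was
  gained earlier for \<open>g\<close>.\<close>

lemma orbit_average_preserves_almost_invariance:
  assumes n: "n > 0" and comm: "g \<circ> h = h \<circ> g"
    and inv: "\<And>A. \<bar>m (g -` A) - m A\<bar> \<le> e"
  shows "\<bar>orbit_average h n m (g -` A) - orbit_average h n m A\<bar> \<le> e"
proof -
  have "(h ^^ i) -` (g -` A) = g -` ((h ^^ i) -` A)" for i
    using funpow_comp_commute[OF comm, of i] by (simp add: vimage_comp)
  then have "orbit_average h n m (g -` A) - orbit_average h n m A
      = (\<Sum>i<n. m (g -` ((h ^^ i) -` A)) - m ((h ^^ i) -` A)) / real n"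
    by (simp add: orbit_average_def sum_subtractf flip: diff_divide_distrib)
  moreover have "\<bar>\<Sum>i<n. m (g -` ((h ^^ i) -` A)) - m ((h ^^ i) -` A)\<bar> \<le> real n * e"
    using sum_norm_bound[of "{..<n}" "\<lambda>i. m (g -` ((h ^^ i) -` A)) - m ((h ^^ i) -` A)" e] inv
    by simp
  ultimately show ?thesis using n by (simp add: pos_divide_le_eq mult.commute)
qed

text \<open>On the compact set of probabilities that are 1 on \<open>F\<close>, averaging over one
  map after another meets any finitely many conditions of approximate invariance; compactness then
  meets all of them.\<close>

lemma invariant_fin_add_prob_exists:
  fixes H :: "('a \<Rightarrow> 'a) set"
  assumes comm: "\<And>g h. g \<in> H \<Longrightarrow> h \<in> H \<Longrightarrow> g \<circ> h = h \<circ> g"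
    and stable: "\<And>h A. h \<in> H \<Longrightarrow> A \<in> F \<Longrightarrow> h -` A \<in> F"
    and fip: "\<And>G. finite G \<Longrightarrow> G \<subseteq> F \<Longrightarrow> \<Inter>G \<noteq> {}"
  shows "\<exists>m\<in>fin_add_probs. (\<forall>h\<in>H. \<forall>A. m (h -` A) = m A) \<and> (\<forall>A\<in>F. m A = 1)"
proof -
  define K where "K = fin_add_probs \<inter> {m. \<forall>A\<in>F. m A = (1::real)}"
  \<comment> \<open>An orbit average is only almost invariant, so invariance is split into closed
    conditions indexed by a map and a precision. \<open>Suc n\<close> keeps the denominator
    positive.\<close>
  define C :: "('a \<Rightarrow> 'a) \<times> nat \<Rightarrow> ('a set \<Rightarrow> real) set"
    where "C = (\<lambda>(h, n). {m. \<forall>A. \<bar>m (h -` A) - m A\<bar> \<le> 1 / real (Suc n)})"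
  have average_K: "orbit_average h (Suc n) m \<in> K" if "m \<in> K" "h \<in> H" for m h n
  proof -
    \<comment> \<open>On a member of \<open>F\<close> every summand of the average is therefore
      1.\<close>
    have "(h ^^ i) -` A \<in> F" if "A \<in> F" for i A
      using that
    proof (induction i arbitrary: A)
      case (Suc i)
      have "(h ^^ Suc i) -` A = (h ^^ i) -` (h -` A)" by auto
      then show ?case using Suc stable \<open>h \<in> H\<close> by metis
    qed simp
    then show ?thesis
      using \<open>m \<in> K\<close> orbit_average_fin_add_probs[of m "Suc n" h]
      by (auto simp: K_def orbit_average_def)
  qed
  have "closed {m. \<forall>A\<in>F. m A = (1::real)}"
    unfolding Ball_def
    by (intro closed_Collect_all closed_Collect_imp closed_Collect_eq continuous_intros
          continuous_on_product_coordinates) simp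
  then have "compact K"
    unfolding K_def by (intro compact_Int_closed compact_fin_add_probs)
  then have "K \<inter> (\<Inter>p\<in>H \<times> UNIV. C p) \<noteq> {}"
  proof (rule compact_imp_fip_image)
    show "closed (C p)" for p
      unfolding C_def split_beta
      by (intro closed_Collect_all closed_Collect_le continuous_intros
            continuous_on_product_coordinates)
    fix I assume "finite I" "I \<subseteq> H \<times> (UNIV :: nat set)"
    then show "K \<inter> (\<Inter>p\<in>I. C p) \<noteq> {}"
    proof (induction I rule: finite_induct)
      case empty
      then show ?case using fip_imp_fin_add_prob[of F] fip by (auto simp: K_def)
    next
      case (insert p I)
      obtain h n where p: "p = (h, n)" by fastforce
      with insert.prems have "h \<in> H" by auto
      from insert obtain m where m: "m \<in> K" "\<And>q. q \<in> I \<Longrightarrow> m \<in> C q" by auto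
      have "orbit_average h (Suc n) m \<in> C q" if "q \<in> I" for q
      proof -
        obtain g k where q: "q = (g, k)" by fastforce
        with that insert.prems have "g \<in> H" by auto
        with m(2)[OF that] show ?thesis
          unfolding q C_def
          by (auto intro!: orbit_average_preserves_almost_invariance comm[OF _ \<open>h \<in> H\<close>])
      qed
      moreover have "orbit_average h (Suc n) m \<in> C p"
        using orbit_average_almost_invariant[of m "Suc n" h] m(1) by (simp add: p C_def K_def)
      ultimately show ?case
        using average_K[OF m(1) \<open>h \<in> H\<close>] by blast
    qed
  qed
  then obtain m where m: "m \<in> K" "\<And>p. p \<in> H \<times> UNIV \<Longrightarrow> m \<in> C p" by blast
  have "m (h -` A) = m A" if "h \<in> H" for h A
  proof (rule ccontr)
    assume "m (h -` A) \<noteq> m A"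
    then have "0 < \<bar>m (h -` A) - m A\<bar>" by simp
    then obtain n where "1 / real (Suc n) < \<bar>m (h -` A) - m A\<bar>"
      using nat_approx_posE by blast
    with m(2)[of "(h, n)"] that show False by (auto simp: C_def not_le[symmetric])
  qed
  with m(1) show ?thesis by (auto simp: K_def)
qed

section \<open>An additive function constant modulo one\<close>

text \<open>Over the rationals, 1 and an irrational \<open>a\<close> are linearly independent, so a
  linear map of the reals can take prescribed values at both.\<close>

lemma additive_function_vanishing_at_1:
  obtains f :: "real \<Rightarrow> real" and a :: real
  where "\<And>x y. f (x + y) = f x + f y" "f 1 = 0" "f a = 1"
proof -
  interpret Q: vector_space "\<lambda>(q::rat) (x::real). of_rat q * x"
    by unfold_locales (auto simp: algebra_simps of_rat_add of_rat_mult)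
  interpret QQ: vector_space_pair "\<lambda>(q::rat) (x::real). of_rat q * x" "\<lambda>(q::rat) (x::real). of_rat q * x"
    by unfold_locales
  have "(UNIV :: real set) \<noteq> \<rat>"
    using uncountable_UNIV_real countable_rat by metis
  then obtain a :: real where a: "a \<notin> \<rat>" by blast
  have "a \<notin> Q.span {1}"
    using a by (auto simp: Q.span_singleton)
  then have ind: "Q.independent {a, 1}" and "a \<noteq> 1"
    using Q.independent_insertI[of a "{1}"] Q.span_base[of 1 "{1}"] by auto
  from QQ.linear_independent_extend[OF ind, of "\<lambda>x. of_bool (x = a)"]
  obtain f where f: "Vector_Spaces.linear (\<lambda>(q::rat) (x::real). of_rat q * x) (\<lambda>(q::rat) (x::real). of_rat q * x) f"
    and fa: "\<forall>x\<in>{a, 1}. f x = of_bool (x = a)"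
    by blast
  show thesis
  proof
    show "f (x + y) = f x + f y" for x y
      using f by (simp add: Vector_Spaces.linear_iff)
  qed (use fa \<open>a \<noteq> 1\<close> in auto)
qed

lemma additive_of_nat_mult:
  fixes f :: "real \<Rightarrow> real"
  assumes "\<And>x y. f (x + y) = f x + f y"
  shows "f (real n * x) = real n * f x"
proof (induction n)
  case 0
  show ?case using assms[of 0 0] by simp
qed (simp add: assms distrib_right)

text \<open>Such an \<open>f\<close> vanishes on the integers, so translation modulo 1 by
  \<open>r\<close> merely adds \<open>f r\<close> to its values.\<close>

lemma additive_frac:
  fixes f :: "real \<Rightarrow> real"
  assumes add: "\<And>x y. f (x + y) = f x + f y" and "f 1 = 0"
  shows "f (frac x) = f x"
proof -
  have nat: "f (real n) = 0" for n
    using additive_of_nat_mult[of f n 1] assms by simp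
  have "f (of_int k) = 0" for k
  proof (cases "k \<ge> 0")
    case True
    then show ?thesis using nat[of "nat k"] by simp
  next
    case False
    then have "f (- of_int k) = 0" using nat[of "nat (- k)"] by simp
    then show ?thesis using add[of "of_int k" "- of_int k"] nat[of 0] by simp
  qed
  then show ?thesis
    using add[of "frac x" "of_int \<lfloor>x\<rfloor>"] by (simp add: frac_def)
qed

section \<open>Total models of chance\<close>

text \<open>Invariance gives all points the same chance. Were it positive, sufficiently many points
  would have total chance above 1.\<close>

lemma total_invariant_imp_finite_null:
  assumes cm: "chance_model (Pow spinner_space) \<mu>" and sy: "Sy_R (Pow spinner_space) \<mu>"
    and T: "finite T" "T \<subseteq> spinner_space"
  shows "\<mu> T = 0"
proof -
  have add: "\<mu> (A \<union> B) = \<mu> A + \<mu> B"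
    if "A \<subseteq> spinner_space" "B \<subseteq> spinner_space" "A \<inter> B = {}" for A B
    using cm that by (simp add: chance_model_def additive_def)
  have le1: "\<mu> A \<le> 1" if "A \<subseteq> spinner_space" for A
    using cm that by (auto simp: chance_model_def Pi_def)
  have ge0: "\<mu> A \<ge> 0" if "A \<subseteq> spinner_space" for A
    using cm that by (auto simp: chance_model_def Pi_def)
  have "translate_mod1 x {0} = {x}" if "x \<in> spinner_space" for x
    using that by (simp add: translate_mod1_def spinner_space_def frac_eq)
  moreover have "\<mu> (translate_mod1 x {0}) = \<mu> {0}" for x
    using sy by (simp add: Sy_R_def spinner_space_def)
  ultimately have point: "\<mu> {x} = \<mu> {0}" if "x \<in> spinner_space" for x
    using that by metis
  have card: "\<mu> U = real (card U) * \<mu> {0}" if "finite U" "U \<subseteq> spinner_space" for U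
    using that
  proof (induction U rule: finite_induct)
    case empty
    show ?case using add[of "{}" "{}"] by simp
  next
    case (insert x U)
    then show ?case using add[of "{x}" U] point[of x] by (simp add: distrib_right)
  qed
  have "infinite spinner_space"
    by (simp add: spinner_space_def)
  have "\<mu> {0} = 0"
  proof (rule ccontr)
    assume "\<mu> {0} \<noteq> 0"
    with ge0[of "{0}"] have pos: "\<mu> {0} > 0" by (simp add: spinner_space_def)
    obtain n where n: "1 < real n * \<mu> {0}" using reals_Archimedean3[OF pos] by blast
    obtain U where "finite U" "card U = n" "U \<subseteq> spinner_space"
      using infinite_arbitrarily_large[OF \<open>infinite spinner_space\<close>] by blast
    with n card[of U] le1[of U] show False by simp
  qed
  with card[OF T] show ?thesis by simp
qed

text \<open>Removing the null endpoints leaves an open interval, and translating it to start at 0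
  leaves a set determined by the length.\<close>

lemma total_invariant_imp_Un_R:
  assumes cm: "chance_model (Pow spinner_space) \<mu>" and sy: "Sy_R (Pow spinner_space) \<mu>"
  shows "Un_R (Pow spinner_space) \<mu>"
proof -
  have length_only: "\<mu> I = \<mu> {0<..<interval_length I}" if "I \<in> spinner_intervals" for I
  proof -
    let ?a = "Inf I" and ?b = "Sup I"
    have I: "is_interval I" "I \<noteq> {}" "I \<subseteq> {0..<1}"
      using that by (auto simp: spinner_intervals_def spinner_space_def)
    have bdd: "bdd_below I" "bdd_above I"
      using bdd_below_mono[OF bdd_below_Ico I(3)] bdd_above_mono[OF bdd_above_Ico I(3)] by auto
    have inside: "{?a<..<?b} \<subseteq> I"
    proof
      fix x assume "x \<in> {?a<..<?b}"
      then obtain u v where "u \<in> I" "u < x" "v \<in> I" "x < v"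
        using cInf_less_iff[OF I(2) bdd(1)] less_cSup_iff[OF I(2) bdd(2)] by auto
      then show "x \<in> I" using I(1) by (meson is_interval_1 less_imp_le)
    qed
    have "I \<subseteq> {?a..?b}"
      using bdd by (auto intro: cInf_lower cSup_upper)
    \<comment> \<open>This form covers open, closed and half-open intervals alike, and also single
      points, where the open part is empty.\<close>
    then have split: "I = {?a<..<?b} \<union> (I \<inter> {?a, ?b})"
      using inside by force
    have "\<mu> ({?a<..<?b} \<union> (I \<inter> {?a, ?b})) = \<mu> {?a<..<?b} + \<mu> (I \<inter> {?a, ?b})"
    proof -
      have "{?a<..<?b} \<inter> (I \<inter> {?a, ?b}) = {}" by auto
      moreover have "{?a<..<?b} \<in> Pow spinner_space" "I \<inter> {?a, ?b} \<in> Pow spinner_space"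
        using inside I(3) by (auto simp: spinner_space_def)
      ultimately show ?thesis
        using cm unfolding chance_model_def additive_def by blast
    qed
    also have "\<mu> (I \<inter> {?a, ?b}) = 0"
      using I(3) by (intro total_invariant_imp_finite_null[OF cm sy]) (auto simp: spinner_space_def)
    finally have "\<mu> I = \<mu> {?a<..<?b}" using split by simp
    also have "\<dots> = \<mu> (translate_mod1 (- ?a) {?a<..<?b})"
      using sy inside I(3) by (auto simp: Sy_R_def spinner_space_def)
    also have "translate_mod1 (- ?a) {?a<..<?b} = {0<..<?b - ?a}"
    proof -
      have "0 \<le> ?a" "?b \<le> 1"
        using I by (auto intro!: cInf_greatest cSup_least)
      \<comment> \<open>The shifted points lie strictly between 0 and 1, so nothing wraps
        around.\<close>
      then have "frac (x + - ?a) = x - ?a" if "x \<in> {?a<..<?b}" for x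
        using that by (auto simp: frac_eq)
      then have "translate_mod1 (- ?a) {?a<..<?b} = (\<lambda>x. x - ?a) ` {?a<..<?b}"
        unfolding translate_mod1_def by (intro image_cong) auto
      then show ?thesis by (auto simp: image_iff algebra_simps intro!: bexI[of _ "_ + ?a"])
    qed
    finally show ?thesis by (simp add: interval_length_def)
  qed
  show ?thesis
    unfolding Un_R_def
  proof (intro conjI ballI impI)
    show "spinner_intervals \<subseteq> Pow spinner_space" by (auto simp: spinner_intervals_def)
    show "\<mu> I = \<mu> J" if "I \<in> spinner_intervals" "J \<in> spinner_intervals"
      "interval_length I = interval_length J" for I J
      using length_only[OF that(1)] length_only[OF that(2)] that(3) by simp
  qed
qed

lemma total_model_concentrated_at_infinity:
  fixes f :: "real \<Rightarrow> real"
  assumes add: "\<And>x y. f (x + y) = f x + f y" and f1: "f 1 = 0" and fa: "f a = 1"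
  obtains \<mu> where "chance_model (Pow spinner_space) \<mu>" "Sy_R (Pow spinner_space) \<mu>"
    "\<And>c. \<mu> {x \<in> spinner_space. f x \<ge> c} = 1"
proof -
  \<comment> \<open>Translations modulo 1 as commuting maps on all of \<open>real\<close>.
    \<open>T 0\<close> is \<open>frac\<close>, not the identity, and invariance under it puts all
    the mass on [0,1).\<close>
  define T where "T r x = frac (x + r)" for r x :: real
  define F where "F = range (\<lambda>c. {x. f x \<ge> c})"
  have fT: "f (T r x) = f x + f r" for r x
    using additive_frac[of f "x + r"] add f1 by (simp add: T_def)
  have "\<exists>m\<in>fin_add_probs. (\<forall>h\<in>range T. \<forall>A. m (h -` A) = m A) \<and> (\<forall>A\<in>F. m A = 1)"
  proof (rule invariant_fin_add_prob_exists)
    show "g \<circ> h = h \<circ> g" if "g \<in> range T" "h \<in> range T" for g h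
      using that by (auto simp: T_def fun_eq_iff ac_simps)
    show "h -` A \<in> F" if "h \<in> range T" "A \<in> F" for h A
    proof -
      from that obtain r c where "h = T r" "A = {x. f x \<ge> c}" by (auto simp: F_def)
      then have "h -` A = {x. f x \<ge> c - f r}" by (auto simp: fT)
      then show ?thesis by (auto simp: F_def)
    qed
    show "\<Inter>G \<noteq> {}" if fin: "finite G" and GF: "G \<subseteq> F" for G
    proof -
      obtain D where D: "finite D" "G = (\<lambda>c. {x. f x \<ge> c}) ` D"
        using finite_subset_image[OF fin GF[unfolded F_def]] by auto
      \<comment> \<open>The common point is \<open>real N * a\<close>, where \<open>f\<close> equals
        \<open>N\<close>; inserting 0 lets \<open>Max\<close> cover an empty
        \<open>D\<close>.\<close>
      obtain N :: nat where "Max (insert 0 D) < real N" using reals_Archimedean2 by blast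
      with D(1) have "\<And>c. c \<in> D \<Longrightarrow> c \<le> real N" by (simp add: less_imp_le)
      then have "real N * a \<in> \<Inter>G"
        using additive_of_nat_mult[of f N a] add fa by (auto simp: D(2))
      then show ?thesis by blast
    qed
  qed
  then obtain m where m: "m \<in> fin_add_probs" and inv: "\<And>r A. m (T r -` A) = m A"
    and mF: "\<And>c. m {x. f x \<ge> c} = 1"
    by (auto simp: F_def)
  have T0_space: "T 0 x \<in> spinner_space" for x
    by (simp add: T_def spinner_space_def frac_lt_1)
  show thesis
  proof
    have "T 0 -` spinner_space = UNIV" using T0_space by auto
    then have "m spinner_space = 1"
      using inv[of 0 spinner_space] m by (simp add: fin_add_probs_def)
    then show "chance_model (Pow spinner_space) m"
      using m by (auto simp: chance_model_def algebra_Pow additive_def fin_add_probs_def)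
    show "Sy_R (Pow spinner_space) m"
      unfolding Sy_R_def
    proof (intro ballI allI conjI)
      fix A r assume A: "A \<in> Pow spinner_space"
      show "translate_mod1 r A \<in> Pow spinner_space"
        by (auto simp: translate_mod1_def spinner_space_def frac_lt_1)
      \<comment> \<open>Invariance of \<open>m\<close> concerns preimages, \<open>Sy_R\<close>
        concerns images. They are linked by the fact that both sides consist of the \<open>x\<close>
        with \<open>frac x \<in> A\<close>.\<close>
      have "T r -` translate_mod1 r A = T 0 -` A"
      proof (intro set_eqI iffI)
        fix x assume "x \<in> T r -` translate_mod1 r A"
        then obtain b where "b \<in> A" "frac (x + r) = frac (b + r)"
          by (auto simp: T_def translate_mod1_def)
        moreover from this have "frac (frac (x + r) + - r) = frac (frac (b + r) + - r)" by simp
        then have "frac x = frac b" unfolding frac_add_simps by simp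
        moreover have "frac b = b" using A \<open>b \<in> A\<close> by (auto simp: spinner_space_def)
        ultimately show "x \<in> T 0 -` A" by (simp add: T_def)
      next
        fix x assume "x \<in> T 0 -` A"
        then have "frac x \<in> A" by (simp add: T_def)
        then have "frac (frac x + r) \<in> translate_mod1 r A"
          unfolding translate_mod1_def by (rule imageI)
        then show "x \<in> T r -` translate_mod1 r A" by (simp add: T_def)
      qed
      then show "m (translate_mod1 r A) = m A"
        using inv[of r "translate_mod1 r A"] inv[of 0 A] by simp
    qed
    fix c
    have "f 0 = 0" using add[of 0 0] by simp
    \<comment> \<open>Since \<open>f\<close> is constant on classes modulo 1, restricting to [0,1)
      loses nothing after pulling back.\<close>
    then have "T 0 -` {x \<in> spinner_space. f x \<ge> c} = {x. f x \<ge> c}"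
      using T0_space by (auto simp: fT)
    then show "m {x \<in> spinner_space. f x \<ge> c} = 1"
      using inv[of 0 "{x \<in> spinner_space. f x \<ge> c}"] mF[of c] by simp
  qed
qed

text \<open>One model lives where \<open>f\<close> is large, the other where \<open>-f\<close> is
  large. The second gives 1 to \<open>?N\<close>, hence 0 to the disjoint set \<open>?P\<close>, to
  which the first gives 1.\<close>

lemma distinct_total_models:
  "\<exists>\<mu> \<nu>. chance_model (Pow spinner_space) \<mu> \<and> Sy_R (Pow spinner_space) \<mu> \<and>
         chance_model (Pow spinner_space) \<nu> \<and> Sy_R (Pow spinner_space) \<nu> \<and>
         distinct_models (Pow spinner_space) \<mu> (Pow spinner_space) \<nu>"
proof -
  obtain f :: "real \<Rightarrow> real" and a where add: "\<And>x y. f (x + y) = f x + f y"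
    and f1: "f 1 = 0" and fa: "f a = 1"
    using additive_function_vanishing_at_1 by metis
  obtain \<mu> where \<mu>: "chance_model (Pow spinner_space) \<mu>" "Sy_R (Pow spinner_space) \<mu>"
    and \<mu>_pos: "\<And>c. \<mu> {x \<in> spinner_space. f x \<ge> c} = 1"
    using total_model_concentrated_at_infinity[OF add f1 fa] by metis
  have "- f (- a) = 1" using add[of a "- a"] add[of 0 0] fa by simp
  then obtain \<nu> where \<nu>: "chance_model (Pow spinner_space) \<nu>" "Sy_R (Pow spinner_space) \<nu>"
    and \<nu>_neg: "\<And>c. \<nu> {x \<in> spinner_space. - f x \<ge> c} = 1"
    using total_model_concentrated_at_infinity[of "\<lambda>x. - f x" "- a"] add f1 by auto
  let ?P = "{x \<in> spinner_space. f x \<ge> 1}" and ?N = "{x \<in> spinner_space. - f x \<ge> 1}"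
  have "\<nu> (?P \<union> ?N) = \<nu> ?P + \<nu> ?N"
  proof -
    have "?P \<inter> ?N = {}" by auto
    then show ?thesis
      using \<nu>(1) unfolding chance_model_def additive_def by blast
  qed
  moreover have "\<nu> (?P \<union> ?N) \<le> 1"
    using \<nu>(1) by (auto simp: chance_model_def Pi_def)
  ultimately have "\<nu> ?P \<noteq> \<mu> ?P"
    using \<nu>_neg[of 1] \<mu>_pos[of 1] by linarith
  then have "distinct_models (Pow spinner_space) \<mu> (Pow spinner_space) \<nu>"
    by (auto simp: distinct_models_def intro!: bexI[of _ ?P])
  with \<mu> \<nu> show ?thesis by blast
qed

theorem corollary4p6:
  shows "(\<exists>\<A> \<mu> \<B> \<nu>.
            chance_model \<A> \<mu> \<and> Sy_R \<A> \<mu> \<and> Un_R \<A> \<mu> \<and> Po \<A> \<and>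
            chance_model \<B> \<nu> \<and> Sy_R \<B> \<nu> \<and> Un_R \<B> \<nu> \<and> Po \<B> \<and>
            distinct_models \<A> \<mu> \<B> \<nu>) \<and>
         (\<exists>\<A> \<mu> \<B> \<nu>.
            chance_model \<A> \<mu> \<and> Sy_R \<A> \<mu> \<and> Un_R \<A> \<mu> \<and> Tot \<A> \<and>
            chance_model \<B> \<nu> \<and> Sy_R \<B> \<nu> \<and> Un_R \<B> \<nu> \<and> Tot \<B> \<and>
            distinct_models \<A> \<mu> \<B> \<nu>)"
proof -
  \<comment> \<open>The same pair of total models serves both claims, as the full power set contains
    every singleton.\<close>
  have "Po (Pow spinner_space)" "Tot (Pow spinner_space)"
    by (auto simp: Po_def Tot_def)
  with distinct_total_models total_invariant_imp_Un_R show ?thesis by blast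
qed

end
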